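(* Let $p$ and $q$ be positive integers and let $r$ be a nonnegative integer. Then for every real number $a>-1$ and every nonnegative integer $m$, $$\sum_{\substack{\boldsymbol{\alpha}\in\mathbb{N}^p\\ |\boldsymbol{\alpha}|=p+m}}\ \sum_{1\le k_1<k_2<\cdots<k_p}(k_1+a)^{-\alpha_1}(k_2+a)^{-\alpha_2}\cdots (k_p+a)^{-\alpha_p}(k_p+r)^{-q}$$ $$=\frac{1}{r!}\sum_{\substack{\boldsymbol{\beta}\in\mathbb{N}^q\\ |\boldsymbol{\beta}|=q+m}}\ \sum_{1\le \ell_1<\ell_2<\cdots<\ell_q}\frac{\ell_1(\ell_1+1)\cdots(\ell_1+r-1)}{(\ell_1+a)^{\beta_1}(\ell_2+a)^{\beta_2}\cdots(\ell_q+a)^{\beta_q}}\sum_{j=0}^r (-1)^j \binom{r}{j}(\ell_q+j)^{-p}.$$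
   Context: $\mathbb{N}$ denotes the set of positive integers. For a tuple $\boldsymbol{\alpha}=(\alpha_1,\ldots,\alpha_n)$ of positive integers, $|\boldsymbol{\alpha}|=\alpha_1+\cdots+\alpha_n$. The sums over $1\le k_1<\cdots<k_p$ and $1\le \ell_1<\cdots<\ell_q$ run over all strictly increasing tuples of positive integers of the indicated length. The product $\ell_1(\ell_1+1)\cdots(\ell_1+r-1)$ has $r$ factors and equals $1$ when $r=0$. *)

theory Defs
  imports "HOL-Analysis.Infinite_Sum"
begin

text \<open>Tuples \<open>(x\<^sub>1, \<dots>, x\<^sub>n)\<close> are lists of length \<open>n\<close>, so \<open>x\<^sub>i\<close> is \<open>xs ! (i - 1)\<close>;
  in particular \<open>x\<^sub>1 = xs ! 0\<close> and \<open>x\<^sub>n = xs ! (n - 1)\<close>.\<close>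

definition compositions :: "nat \<Rightarrow> nat \<Rightarrow> nat list set" where
  "compositions n w = {xs. length xs = n \<and> (\<forall>x\<in>set xs. 1 \<le> x) \<and> sum_list xs = w}"

definition increasing_tuples :: "nat \<Rightarrow> nat list set" where
  "increasing_tuples n = {xs. length xs = n \<and> (\<forall>x\<in>set xs. 1 \<le> x) \<and> sorted_wrt (<) xs}"

definition lhs_summand ::
    "nat \<Rightarrow> nat \<Rightarrow> nat \<Rightarrow> real \<Rightarrow> nat list \<Rightarrow> nat list \<Rightarrow> real" where
  "lhs_summand p q r a \<alpha> k =
     (\<Prod>i<p. (real (k ! i) + a) powi (- int (\<alpha> ! i)))
       * (real (k ! (p - 1)) + real r) powi (- int q)"

definition rhs_summand ::
    "nat \<Rightarrow> nat \<Rightarrow> nat \<Rightarrow> real \<Rightarrow> nat list \<Rightarrow> nat list \<Rightarrow> real" where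
  "rhs_summand p q r a \<beta> l =
     (\<Prod>i<r. real (l ! 0) + real i) / (\<Prod>i<q. (real (l ! i) + a) ^ (\<beta> ! i))
       * (\<Sum>j=0..r. (- 1) ^ j * real (r choose j) * (real (l ! (q - 1)) + real j) powi (- int p))"

end

theory Submission
  imports Defs "HOL-Analysis.Analysis"
begin

text \<open>Write \<open>(x)\<^sub>n\<close> for the Pochhammer symbol. For \<open>m = 0\<close>, sum the nonnegative kernel
  \[ F(k, l) = \prod_i \frac{1}{k_i + a} \prod_i \frac{1}{l_i + a} \cdot \frac{(l_1)_r}{r!} \cdot
       \frac{(k_p)_r\, (1 + a)_{k_p}}{(l_q + a + 1)_{k_p + r}} \]
  over all pairs of increasing tuples in both orders (a connected sum in the style of Seki and
  Yamamoto). The relation \<open>\<Sum>\<^bsub>j > n\<^esub> 1 / (j + a)\<^bsub>N+1\<^esub> = 1 / (N (n + 1 + a)\<^sub>N)\<close> removes the entries of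
  a tuple one at a time, starting from the last: summing over \<open>l\<close> first gives the term of the left-hand side
  at \<open>k\<close>, and summing over \<open>k\<close> first gives the term of the right-hand side at \<open>l\<close>.

  Since \<open>1 / (k + a - x) = \<Sum>\<^bsub>n \<ge> 1\<^esub> x\<^bsup>n-1\<^esup> / (k + a)\<^sup>n\<close>, the case \<open>m = 0\<close> with \<open>a - x\<close> in place of \<open>a\<close>,
  for \<open>0 \<le> x < 1 + a\<close>, is an identity between the generating functions in \<open>x\<close> of the two sides over all
  \<open>m\<close>, so their coefficients agree.\<close>

subsection \<open>Double sums and power series\<close>

text \<open>Tonelli: for nonnegative terms, convergence of the iterated sum already gives
  convergence over all pairs.\<close>

lemma has_sum_Sigma_nonneg:
  fixes f :: "'a \<Rightarrow> 'b \<Rightarrow> real"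
  assumes "\<And>x. x \<in> A \<Longrightarrow> (f x has_sum g x) (B x)"
    and "(g has_sum S) A"
    and "\<And>x y. x \<in> A \<Longrightarrow> y \<in> B x \<Longrightarrow> f x y \<ge> 0"
  shows "((\<lambda>(x, y). f x y) has_sum S) (Sigma A B)"
proof (rule has_sum_SigmaI[where g = g])
  show "(\<lambda>(x, y). f x y) summable_on Sigma A B"
    by (rule summable_on_SigmaI[where g = g]) (use assms in \<open>auto simp: has_sum_imp_summable\<close>)
qed (use assms in auto)

lemma has_sum_Sigma_flip_nonneg:
  fixes f :: "'a \<Rightarrow> 'b \<Rightarrow> real"
  assumes "\<And>x. x \<in> A \<Longrightarrow> (f x has_sum g x) (B x)"
    and "(g has_sum S) A"
    and "\<And>x y. x \<in> A \<Longrightarrow> y \<in> B x \<Longrightarrow> f x y \<ge> 0"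
    and "\<And>x y. x \<in> A \<and> y \<in> B x \<longleftrightarrow> y \<in> C \<and> x \<in> D y"
  shows "((\<lambda>(y, x). f x y) has_sum S) (Sigma C D)"
proof -
  have "bij_betw prod.swap (Sigma C D) (Sigma A B)"
    by (rule bij_betwI[where g = prod.swap]) (use assms(4) in \<open>auto; metis\<close>)+
  from has_sum_reindex_bij_betw[OF this, of "\<lambda>(x, y). f x y" S]
    has_sum_Sigma_nonneg[OF assms(1-3)]
  show ?thesis by (simp add: case_prod_unfold)
qed

text \<open>Tonelli again, with convergence known in one order only. The inner ranges may depend on
  the outer variable; the fourth condition says that both orders run over the same pairs, for
  instance a triangle \<open>i \<le> l\<close>.\<close>

lemma has_sum_swap_nonneg:
  fixes f :: "'a \<Rightarrow> 'b \<Rightarrow> real"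
  assumes "\<And>x. x \<in> A \<Longrightarrow> (f x has_sum g x) (B x)"
    and "(g has_sum S) A"
    and "\<And>x y. x \<in> A \<Longrightarrow> y \<in> B x \<Longrightarrow> f x y \<ge> 0"
    and "\<And>x y. x \<in> A \<and> y \<in> B x \<longleftrightarrow> y \<in> C \<and> x \<in> D y"
    and "\<And>y. y \<in> C \<Longrightarrow> ((\<lambda>x. f x y) has_sum h y) (D y)"
  shows "(h has_sum S) C"
  by (rule has_sum_SigmaD[OF has_sum_Sigma_flip_nonneg[OF assms(1-4)]]) (use assms(5) in auto)

lemma has_sum_sum:
  fixes f :: "'i \<Rightarrow> 'a \<Rightarrow> 'b :: topological_comm_monoid_add"
  assumes "finite I" and "\<And>i. i \<in> I \<Longrightarrow> (f i has_sum S i) A"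
  shows "((\<lambda>x. \<Sum>i\<in>I. f i x) has_sum (\<Sum>i\<in>I. S i)) A"
  using assms by (induction I rule: finite_induct) (auto intro!: has_sum_add has_sum_0)

text \<open>Once the lower coefficients vanish, division by \<open>x ^ m\<close> leaves a series
  with constant term \<open>e m\<close>, and \<open>x\<close> tends to 0 from the right. Only
  \<open>x > 0\<close> is assumed because the generating functions below are compared for such
  \<open>x\<close>, where their terms are nonnegative.\<close>

lemma powser_eq_0_right_imp_coeff_eq_0:
  fixes e :: "nat \<Rightarrow> real"
  assumes "\<rho> > 0" and "\<And>x. 0 < x \<Longrightarrow> x < \<rho> \<Longrightarrow> (\<lambda>n. e n * x ^ n) sums 0"
  shows "e m = 0"
proof (induction m rule: less_induct)
  case (less m)
  have shifted: "(\<lambda>n. e (n + m) * x ^ n) sums 0" if x: "0 < x" "x < \<rho>" for x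
  proof -
    have "(\<lambda>n. e (n + m) * x ^ (n + m)) sums 0"
      using sums_split_initial_segment[OF assms(2)[OF x], of m] less by simp
    from sums_mult[OF this, of "1 / x ^ m"] show ?thesis
      using x by (simp add: power_add)
  qed
  define f where "f x = (\<Sum>n. e (n + m) * x ^ n)" for x
  have "(f \<longlongrightarrow> e (0 + m)) (at 0)"
  \<comment> \<open>This limit rule asks for convergence on both sides of 0; convergence at the
    single point \<open>\<rho> / 2\<close> provides it.\<close>
  proof (rule powser_limit_0)
    show "\<rho> / 2 > 0" using assms by simp
    fix x :: real assume x: "norm x < \<rho> / 2"
    have "summable (\<lambda>n. e (n + m) * (\<rho> / 2) ^ n)"
      using shifted[of "\<rho> / 2"] assms by (simp add: sums_iff)
    from powser_inside[OF this, of x] have "summable (\<lambda>n. e (n + m) * x ^ n)"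
      using x by simp
    thus "(\<lambda>n. e (n + m) * x ^ n) sums f x"
      by (simp add: f_def summable_sums)
  qed
  hence "(f \<longlongrightarrow> e m) (at_right 0)"
    by (simp add: filterlim_at_split)
  moreover have "(f \<longlongrightarrow> 0) (at_right 0)"
  proof (rule tendsto_eventually)
    have "eventually (\<lambda>x. x \<in> {0<..<\<rho>}) (at_right (0::real))"
      by (rule eventually_at_right_real) (use assms in auto)
    thus "eventually (\<lambda>x. f x = 0) (at_right 0)"
      by eventually_elim (use shifted in \<open>auto simp: f_def sums_iff\<close>)
  qed
  ultimately show "e m = 0"
    using tendsto_unique trivial_limit_at_right_real by blast
qed

subsection \<open>Reciprocals of Pochhammer symbols\<close>

lemma inverse_pochhammer_tendsto_0:
  fixes z :: real
  assumes "N > 0"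
  shows "(\<lambda>j. 1 / pochhammer (z + real j) N) \<longlonglongrightarrow> 0"
  using assms
proof (induction N rule: nat_induct_non_zero)
  have lim: "(\<lambda>j. 1 / (c + real j)) \<longlonglongrightarrow> 0" for c :: real
    by (intro tendsto_divide_0[OF tendsto_const] filterlim_at_top_imp_at_infinity
        filterlim_tendsto_add_at_top[OF tendsto_const] filterlim_real_sequentially)
  {
    case 1
    show ?case using lim[of z] by simp
  next
    case (Suc N)
    from tendsto_mult[OF Suc.IH lim[of "z + real N"]] show ?case
      by (simp add: pochhammer_Suc add_ac)
  }
qed

text \<open>Over the common denominator \<open>pochhammer z (Suc N)\<close> the two fractions have
  numerators \<open>z + N\<close> and \<open>z\<close>.\<close>

lemma inverse_pochhammer_diff:
  fixes z :: real
  assumes "z > 0"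
  shows "1 / pochhammer z N - 1 / pochhammer (z + 1) N = real N / pochhammer z (Suc N)"
proof -
  have pos: "pochhammer z N > 0" "pochhammer (z + 1) N > 0"
    using assms by (auto intro: pochhammer_pos)
  have "z * pochhammer (z + 1) N = pochhammer z N * (z + real N)"
    by (metis pochhammer_Suc pochhammer_rec)
  moreover have "pochhammer z (Suc N) = pochhammer z N * (z + real N)"
    by (rule pochhammer_Suc)
  ultimately have "1 / pochhammer z N = (z + real N) / pochhammer z (Suc N)"
    and "1 / pochhammer (z + 1) N = z / pochhammer z (Suc N)"
    using pos assms by (auto simp: divide_simps)
  thus ?thesis by (simp add: add_divide_distrib)
qed

text \<open>By \<open>inverse_pochhammer_diff\<close> each term is a difference of consecutive
  values of \<open>f\<close>, divided by \<open>N\<close>, so the series telescopes.\<close>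

lemma has_sum_inverse_pochhammer:
  fixes a :: real
  assumes "a + real m > 0" and "N > 0"
  shows "((\<lambda>j. 1 / pochhammer (real j + a) (Suc N)) has_sum
           1 / (real N * pochhammer (real m + a) N)) {m..}"
proof -
  define f where "f j = 1 / pochhammer (real m + a + real j) N" for j
  have "f \<longlonglongrightarrow> 0"
    unfolding f_def by (rule inverse_pochhammer_tendsto_0[OF assms(2)])
  from sums_divide[OF telescope_sums'[OF this], of "real N"]
  have "(\<lambda>n. (f n - f (Suc n)) / real N) sums (1 / (real N * pochhammer (real m + a) N))"
    by (simp add: f_def mult_ac)
  moreover have "(f n - f (Suc n)) / real N = 1 / pochhammer (real (n + m) + a) (Suc N)" for n
    using inverse_pochhammer_diff[of "real m + a + real n" N] assms
    by (simp add: f_def add_ac)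
  ultimately have "((\<lambda>n. 1 / pochhammer (real (n + m) + a) (Suc N)) has_sum
      1 / (real N * pochhammer (real m + a) N)) UNIV"
    by (intro sums_nonneg_imp_has_sum) (use assms in \<open>auto intro!: pochhammer_nonneg simp del: pochhammer_Suc\<close>)
  moreover have "bij_betw (\<lambda>n. n + m) UNIV {m..}"
    by (rule bij_betwI[where g = "\<lambda>n. n - m"]) auto
  ultimately show ?thesis
    using has_sum_reindex_bij_betw[of "\<lambda>n. n + m" UNIV "{m..}"] by fastforce
qed

text \<open>The hockey-stick identity: the summand is the binomial coefficient
  \<open>(i + r - 1) choose r\<close>.\<close>

lemma sum_pochhammer_div_fact:
  "(\<Sum>i=1..l. pochhammer (real i) r / fact r) = pochhammer (real l) (Suc r) / fact (Suc r)"
proof (induction l)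
  case (Suc l)
  have "pochhammer (real l) (Suc r) / fact (Suc r) + pochhammer (real l + 1) r / fact r
      = pochhammer (real l + 1) r * (real l + 1 + real r) / fact (Suc r)"
    unfolding pochhammer_rec by (simp add: divide_simps) (simp add: algebra_simps)
  with Suc show ?case
    by (simp add: pochhammer_Suc add_ac)
qed (simp add: pochhammer_0_left)

text \<open>A Gauss sum \<open>\<^sub>2F\<^sub>1(r + 1, 1 + a; k + r + a + 2; 1)\<close> in disguise. Here it follows
  from the telescoping case \<open>r = 0\<close> by repeated partial summation.\<close>

lemma has_sum_pochhammer_quotient:
  fixes a :: real
  assumes "a > -1" and "k > 0"
  shows "((\<lambda>l. pochhammer (real l) r / fact r / pochhammer (real l + a) (Suc (k + r))) has_sum
           1 / (pochhammer (1 + a) k * pochhammer (real k) (Suc r))) {1..}"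
proof (induction r)
  case 0
  show ?case
    using has_sum_inverse_pochhammer[of a 1 k] assms by (simp add: mult_ac)
next
  case (Suc r)
  let ?g = "\<lambda>i. pochhammer (real i) r / fact r :: real"
  let ?N = "Suc (k + r)"
  define c where "c = pochhammer (1 + a) k * pochhammer (real k) (Suc r)"
  show ?case
  \<comment> \<open>The double series runs over \<open>1 \<le> i \<le> l\<close>. Summing over
    \<open>i\<close> first gives the wanted series by the hockey-stick identity; summing over
    \<open>l\<close> first telescopes to the series of the induction hypothesis divided by
    \<open>?N\<close>.\<close>
  proof (rule has_sum_swap_nonneg)
    fix i :: nat assume "i \<in> {1..}"
    hence "((\<lambda>l. 1 / pochhammer (real l + a) (Suc ?N)) has_sum
           1 / (real ?N * pochhammer (real i + a) ?N)) {i..}"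
      using assms by (intro has_sum_inverse_pochhammer) auto
    from has_sum_cmult_right[OF this, of "?g i"]
    show "((\<lambda>l. ?g i / pochhammer (real l + a) (Suc ?N)) has_sum
           ?g i / pochhammer (real i + a) ?N / real ?N) {i..}"
      by (simp add: mult_ac)
  next
    have "((\<lambda>i. ?g i / pochhammer (real i + a) ?N / real ?N) has_sum (1 / c) / real ?N) {1..}"
      unfolding c_def by (intro has_sum_divide_const Suc)
    also have "(1 / c) / real ?N = 1 / (pochhammer (1 + a) k * pochhammer (real k) (Suc (Suc r)))"
      by (simp add: c_def pochhammer_Suc[of _ "Suc r"] add_ac)
    finally show "((\<lambda>i. ?g i / pochhammer (real i + a) ?N / real ?N) has_sum \<dots>) {1..}" .
  next
    fix i l :: nat assume "i \<in> {1..}" "l \<in> {i..}"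
    thus "0 \<le> ?g i / pochhammer (real l + a) (Suc ?N)"
      using assms by (intro divide_nonneg_nonneg pochhammer_nonneg) auto
  next
    fix i l :: nat
    show "i \<in> {1..} \<and> l \<in> {i..} \<longleftrightarrow> l \<in> {1..} \<and> i \<in> {1..l}" by auto
  next
    fix l :: nat assume "l \<in> {1..}"
    show "((\<lambda>i. ?g i / pochhammer (real l + a) (Suc ?N)) has_sum
            pochhammer (real l) (Suc r) / fact (Suc r) / pochhammer (real l + a) (Suc (k + Suc r))) {1..l}"
      unfolding sum_pochhammer_div_fact[symmetric] sum_divide_distrib by (rule has_sum_finiteI) simp_all
  qed
qed

text \<open>The left side is the \<open>r\<close>-fold iterated difference
  \<open>f z - f (z + 1)\<close> of \<open>1 / pochhammer z k\<close>. Each further difference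
  lengthens the symbol by one and contributes one factor of \<open>pochhammer k r\<close>.\<close>

lemma alternating_sum_inverse_pochhammer:
  fixes z :: real
  assumes "z > 0"
  shows "(\<Sum>j=0..r. (- 1) ^ j * real (r choose j) / pochhammer (z + real j) k)
           = pochhammer (real k) r / pochhammer z (k + r)"
  using assms
proof (induction r arbitrary: z)
  case (Suc r)
  let ?f = "\<lambda>j. 1 / pochhammer (z + real j) k"
  have "(\<Sum>j=0..Suc r. (- 1) ^ j * real (Suc r choose j) / pochhammer (z + real j) k)
      = (\<Sum>j\<le>Suc r. (- 1) ^ j * real (Suc r choose j) * ?f j)"
    by (simp add: atLeast0AtMost)
  also have "\<dots> = ?f 0 + (\<Sum>j\<le>r. (- 1) ^ Suc j * real (Suc r choose Suc j) * ?f (Suc j))"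
    by (subst sum.atMost_Suc_shift) simp
  \<comment> \<open>Pascal's rule separates the alternating sum at \<open>z\<close> from the one at
    \<open>z + 1\<close>.\<close>
  also have "(\<Sum>j\<le>r. (- 1) ^ Suc j * real (Suc r choose Suc j) * ?f (Suc j))
      = (\<Sum>j\<le>r. (- 1) ^ Suc j * real (r choose Suc j) * ?f (Suc j))
        - (\<Sum>j\<le>r. (- 1) ^ j * real (r choose j) * ?f (Suc j))"
    by (subst sum_subtractf[symmetric], rule sum.cong[OF refl]) (simp add: algebra_simps add_divide_distrib diff_divide_distrib)
  also have "?f 0 + (\<dots>) = (?f 0 + (\<Sum>j\<le>r. (- 1) ^ Suc j * real (r choose Suc j) * ?f (Suc j)))
        - (\<Sum>j\<le>r. (- 1) ^ j * real (r choose j) * ?f (Suc j))"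
    by simp
  also have "?f 0 + (\<Sum>j\<le>r. (- 1) ^ Suc j * real (r choose Suc j) * ?f (Suc j))
      = (\<Sum>j\<le>Suc r. (- 1) ^ j * real (r choose j) * ?f j)"
    by (subst sum.atMost_Suc_shift) simp
  also have "\<dots> = (\<Sum>j=0..r. (- 1) ^ j * real (r choose j) / pochhammer (z + real j) k)"
    by (simp add: atLeast0AtMost)
  also have "\<dots> = pochhammer (real k) r / pochhammer z (k + r)"
    using Suc by simp
  also have "(\<Sum>j\<le>r. (- 1) ^ j * real (r choose j) * ?f (Suc j))
      = (\<Sum>j=0..r. (- 1) ^ j * real (r choose j) / pochhammer (z + 1 + real j) k)"
    by (simp add: atLeast0AtMost add_ac)
  also have "\<dots> = pochhammer (real k) r / pochhammer (z + 1) (k + r)"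
    using Suc by simp
  also have "pochhammer (real k) r / pochhammer z (k + r) - pochhammer (real k) r / pochhammer (z + 1) (k + r)
      = pochhammer (real k) r * (real (k + r) / pochhammer z (Suc (k + r)))"
    by (simp only: inverse_pochhammer_diff[OF Suc.prems, symmetric] right_diff_distrib times_divide_eq_right mult_1_right)
  also have "\<dots> = pochhammer (real k) (Suc r) / pochhammer z (k + Suc r)"
    by (simp add: pochhammer_Suc)
  finally show ?case .
qed auto

subsection \<open>Sums over increasing tuples\<close>

lemma increasing_tuples_1_bij: "bij_betw (\<lambda>l. [l]) {1..} (increasing_tuples 1)"
  by (rule bij_betwI[where g = hd]) (auto simp: increasing_tuples_def length_Suc_conv)

text \<open>This is the induction step for sums over tuples: the last entry is split off and ranges
  freely above its predecessor \<open>l ! (q - 1)\<close>.\<close>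

lemma increasing_tuples_Suc_bij:
  assumes "q > 0"
  shows "bij_betw (\<lambda>(l, j). l @ [j]) (SIGMA l : increasing_tuples q. {Suc (l ! (q - 1))..})
           (increasing_tuples (Suc q))"
proof (rule bij_betwI[where g = "\<lambda>xs. (butlast xs, last xs)"])
  show "(\<lambda>(l, j). l @ [j]) \<in> (SIGMA l : increasing_tuples q. {Suc (l ! (q - 1))..}) \<rightarrow> increasing_tuples (Suc q)"
  proof (safe)
    fix l j assume *: "l \<in> increasing_tuples q" "Suc (l ! (q - 1)) \<le> j"
    have "l ! i < j" if "i < q" for i
    proof (cases "i = q - 1")
      case False
      with that have "l ! i < l ! (q - 1)"
        using * by (intro sorted_wrt_nth_less[of "(<)"]) (auto simp: increasing_tuples_def)
      with * show ?thesis by simp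
    qed (use * in auto)
    with * show "l @ [j] \<in> increasing_tuples (Suc q)"
      by (auto simp: increasing_tuples_def sorted_wrt_append in_set_conv_nth)
  qed
  show "(\<lambda>xs. (butlast xs, last xs)) \<in> increasing_tuples (Suc q) \<rightarrow> (SIGMA l : increasing_tuples q. {Suc (l ! (q - 1))..})"
  proof
    fix xs assume *: "xs \<in> increasing_tuples (Suc q)"
    then obtain l j where xs: "xs = l @ [j]"
      by (cases xs rule: rev_cases) (auto simp: increasing_tuples_def)
    have "l ! (q - 1) \<in> set l"
      using * assms by (intro nth_mem) (auto simp: increasing_tuples_def xs)
    with * show "(butlast xs, last xs) \<in> (SIGMA l : increasing_tuples q. {Suc (l ! (q - 1))..})"
      by (auto simp: increasing_tuples_def xs sorted_wrt_append Suc_le_eq)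
  qed
qed (auto simp: increasing_tuples_def intro!: append_butlast_last_id)

lemma increasing_tuples_nth_ge_1: "k \<in> increasing_tuples p \<Longrightarrow> i < p \<Longrightarrow> 1 \<le> k ! i"
  by (auto simp: increasing_tuples_def)

text \<open>The product with all exponents equal to 1, which is the only choice of exponents when
  \<open>m = 0\<close>.\<close>

definition recip_prod :: "real \<Rightarrow> nat \<Rightarrow> nat list \<Rightarrow> real" where
  "recip_prod a p k = (\<Prod>i<p. 1 / (real (k ! i) + a))"

lemma recip_prod_nonneg:
  assumes "a > -1" and "k \<in> increasing_tuples p"
  shows "recip_prod a p k \<ge> 0"
  unfolding recip_prod_def
proof (rule prod_nonneg, safe)
  fix i assume "i < p"
  thus "1 / (real (k ! i) + a) \<ge> 0"
    using increasing_tuples_nth_ge_1[OF assms(2), of i] assms(1) by simp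
qed

lemma recip_prod_snoc:
  assumes "l \<in> increasing_tuples q"
  shows "recip_prod a (Suc q) (l @ [j]) = recip_prod a q l / (real j + a)"
  using assms by (simp add: recip_prod_def increasing_tuples_def nth_append)

text \<open>The factor \<open>1 / (j + a)\<close> of the last entry completes the symbol to
  \<open>pochhammer (j + a) (Suc N)\<close>. Telescoping over \<open>j\<close> then yields a factor
  \<open>1 / N\<close> and a term of the same shape for the shorter tuple. The weight
  \<open>g\<close> sees only the first entry, so after \<open>q - 1\<close> removals the
  one-variable sum \<open>S\<close> is left.\<close>

lemma has_sum_increasing_tuples_inverse_pochhammer:
  fixes a :: real
  assumes "a > -1" and "N > 0" and "q > 0" and g_nonneg: "\<And>l. g l \<ge> 0"
    and g: "((\<lambda>l. g l / pochhammer (real l + a) (Suc N)) has_sum S) {1..}"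
  shows "((\<lambda>l. g (l ! 0) * recip_prod a q l / pochhammer (real (l ! (q - 1)) + a + 1) N)
           has_sum S / real N ^ (q - 1)) (increasing_tuples q)"
  using \<open>q > 0\<close>
proof (induction q rule: nat_induct_non_zero)
  case 1
  have "((\<lambda>l. g ([l] ! 0) * recip_prod a 1 [l] / pochhammer (real ([l] ! (1 - 1)) + a + 1) N)
           has_sum S) {1..}"
    using g by (simp add: recip_prod_def pochhammer_rec)
  thus ?case
    unfolding has_sum_reindex_bij_betw[OF increasing_tuples_1_bij,
        where f = "\<lambda>l. g (l ! 0) * recip_prod a 1 l / pochhammer (real (l ! (1 - 1)) + a + 1) N"]
    by simp
next
  case (Suc q)
  let ?T = "\<lambda>q l. g (l ! 0) * recip_prod a q l / pochhammer (real (l ! (q - 1)) + a + 1) N"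
  have "((\<lambda>(l, j). ?T (Suc q) (l @ [j])) has_sum S / real N ^ (q - 1) / real N)
          (SIGMA l : increasing_tuples q. {Suc (l ! (q - 1))..})"
  proof (rule has_sum_Sigma_nonneg)
    fix l assume l: "l \<in> increasing_tuples q"
    have eq: "?T (Suc q) (l @ [j]) = g (l ! 0) * recip_prod a q l * (1 / pochhammer (real j + a) (Suc N))" for j
      using l Suc.hyps
      by (simp add: recip_prod_snoc pochhammer_rec) (auto simp: increasing_tuples_def nth_append)
    have "((\<lambda>j. 1 / pochhammer (real j + a) (Suc N)) has_sum
           1 / (real N * pochhammer (real (Suc (l ! (q - 1))) + a) N)) {Suc (l ! (q - 1))..}"
      using assms by (intro has_sum_inverse_pochhammer) auto
    from has_sum_cmult_right[OF this, of "g (l ! 0) * recip_prod a q l"]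
    show "((\<lambda>j. ?T (Suc q) (l @ [j])) has_sum ?T q l / real N) {Suc (l ! (q - 1))..}"
      unfolding eq by (simp add: add_ac mult_ac)
    fix j assume "j \<in> {Suc (l ! (q - 1))..}"
    thus "?T (Suc q) (l @ [j]) \<ge> 0"
      unfolding eq using assms l
      by (intro mult_nonneg_nonneg divide_nonneg_nonneg pochhammer_nonneg recip_prod_nonneg g_nonneg) auto
  next
    show "((\<lambda>l. ?T q l / real N) has_sum S / real N ^ (q - 1) / real N) (increasing_tuples q)"
      by (intro has_sum_divide_const Suc.IH)
  qed
  hence "(?T (Suc q) has_sum S / real N ^ (q - 1) / real N) (increasing_tuples (Suc q))"
    using has_sum_reindex_bij_betw[OF increasing_tuples_Suc_bij[OF \<open>q > 0\<close>], of "?T (Suc q)"]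
    by (simp add: case_prod_unfold)
  also have "S / real N ^ (q - 1) / real N = S / real N ^ (Suc q - 1)"
    using Suc.hyps by (cases q) simp_all
  finally show ?case .
qed

section \<open>The connected sum and its two evaluations\<close>

text \<open>The last factor connects the tuples through their last entries only. For
  \<open>r = 0\<close> it equals \<open>(1 + a)_k (1 + a)_l / (1 + a)_(k + l)\<close> at these
  entries, which is symmetric in them.\<close>

definition connected_kernel ::
    "nat \<Rightarrow> nat \<Rightarrow> nat \<Rightarrow> real \<Rightarrow> nat list \<Rightarrow> nat list \<Rightarrow> real" where
  "connected_kernel p q r a k l =
     recip_prod a p k * recip_prod a q l * (pochhammer (real (l ! 0)) r / fact r)
       * (pochhammer (real (k ! (p - 1))) r * pochhammer (1 + a) (k ! (p - 1))
           / pochhammer (real (l ! (q - 1)) + a + 1) (k ! (p - 1) + r))"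

lemma connected_kernel_nonneg:
  assumes "a > -1" "p > 0" "q > 0" "k \<in> increasing_tuples p" "l \<in> increasing_tuples q"
  shows "connected_kernel p q r a k l \<ge> 0"
  unfolding connected_kernel_def
  using increasing_tuples_nth_ge_1[OF assms(4), of "p - 1"]
    increasing_tuples_nth_ge_1[OF assms(5), of 0] assms
  by (intro mult_nonneg_nonneg divide_nonneg_nonneg recip_prod_nonneg pochhammer_nonneg) auto

text \<open>For fixed \<open>k\<close> the entries of \<open>l\<close> are removed with
  \<open>N = k ! (p - 1) + r\<close>; the remaining sum over the first entry is
  \<open>has_sum_pochhammer_quotient\<close>.\<close>

lemma has_sum_connected_kernel_right:
  assumes "a > -1" "p > 0" "q > 0" "k \<in> increasing_tuples p"
  shows "(connected_kernel p q r a k has_sum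
           recip_prod a p k / (real (k ! (p - 1)) + real r) ^ q) (increasing_tuples q)"
proof -
  define n where "n = k ! (p - 1)"
  have n: "n > 0"
    using increasing_tuples_nth_ge_1[OF assms(4), of "p - 1"] assms by (simp add: n_def)
  define c where "c = pochhammer (real n) r * pochhammer (1 + a) n"
  have c: "c > 0"
    unfolding c_def using n assms by (intro mult_pos_pos pochhammer_pos) auto
  have "((\<lambda>l. pochhammer (real (l ! 0)) r / fact r * recip_prod a q l /
              pochhammer (real (l ! (q - 1)) + a + 1) (n + r))
           has_sum 1 / (pochhammer (1 + a) n * pochhammer (real n) (Suc r)) / real (n + r) ^ (q - 1))
         (increasing_tuples q)"
  proof (rule has_sum_increasing_tuples_inverse_pochhammer)
    show "pochhammer (real l) r / fact r \<ge> 0" for l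
      by (cases "l = 0") (auto intro!: pochhammer_nonneg divide_nonneg_nonneg simp: pochhammer_0_left)
  qed (use assms n has_sum_pochhammer_quotient[of a n r] in auto)
  \<comment> \<open>The factor \<open>c\<close> is the numerator of the connecting factor. It
    cancels, and the left-over \<open>n + r\<close> joins the \<open>q - 1\<close> factors from the
    removals to form the \<open>q\<close>-th power.\<close>
  from has_sum_cmult_right[OF this, of "recip_prod a p k * c"]
  have "(connected_kernel p q r a k has_sum recip_prod a p k * c *
          (1 / (pochhammer (1 + a) n * pochhammer (real n) (Suc r)) / real (n + r) ^ (q - 1)))
         (increasing_tuples q)"
    by (simp add: connected_kernel_def[abs_def] n_def c_def mult_ac)
  also have "pochhammer (1 + a) n * pochhammer (real n) (Suc r) = c * real (n + r)"
    by (simp add: c_def pochhammer_Suc mult_ac)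
  also have "recip_prod a p k * c * (1 / (c * real (n + r)) / real (n + r) ^ (q - 1))
      = recip_prod a p k / (real (n + r) * real (n + r) ^ (q - 1))"
    using c by simp
  also have "real (n + r) * real (n + r) ^ (q - 1) = (real n + real r) ^ q"
    using assms by (simp flip: power_Suc)
  finally show ?thesis by (simp add: n_def)
qed

text \<open>With \<open>m\<close> the last entry of \<open>k\<close>, the identity
  \<open>(1 + a)_n (1 + a + n)_m = (1 + a)_m (1 + a + m)_n\<close> moves that entry from the length
  of the symbol to its base. The entries of \<open>k\<close> can then be removed with
  \<open>N = n\<close> and constant weight.\<close>

lemma has_sum_recip_prod_inverse_power:
  assumes "a > -1" "p > 0" "n > 0"
  shows "((\<lambda>k. recip_prod a p k * (pochhammer (1 + a) (k ! (p - 1))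
             / pochhammer (real n + a + 1) (k ! (p - 1)))) has_sum 1 / real n ^ p)
          (increasing_tuples p)"
proof -
  define c where "c = pochhammer (1 + a) n"
  have c: "c > 0" unfolding c_def using assms by (intro pochhammer_pos) auto
  have "((\<lambda>k. 1 * recip_prod a p k / pochhammer (real (k ! (p - 1)) + a + 1) n) has_sum
          1 / (real n * pochhammer (real 1 + a) n) / real n ^ (p - 1)) (increasing_tuples p)"
    using assms by (intro has_sum_increasing_tuples_inverse_pochhammer[where g = "\<lambda>_. 1"]
        has_sum_inverse_pochhammer) auto
  from has_sum_cmult_right[OF this, of c]
  have "((\<lambda>k. recip_prod a p k * (c / pochhammer (real (k ! (p - 1)) + a + 1) n)) has_sum
          1 / (real n * real n ^ (p - 1))) (increasing_tuples p)"
    using c by (simp add: c_def mult_ac)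
  moreover have "real n * real n ^ (p - 1) = real n ^ p"
    using assms by (simp flip: power_Suc)
  moreover have "c / pochhammer (real m + a + 1) n
      = pochhammer (1 + a) m / pochhammer (real n + a + 1) m" for m
  proof -
    have "pochhammer (1 + a) n * pochhammer (1 + a + real n) m
        = pochhammer (1 + a) m * pochhammer (1 + a + real m) n"
      by (metis pochhammer_product' add.commute)
    moreover have "pochhammer (1 + a + real n) m > 0" "pochhammer (1 + a + real m) n > 0"
      using assms by (auto intro!: pochhammer_pos)
    ultimately show ?thesis
      by (simp add: c_def divide_simps add_ac)
  qed
  ultimately show ?thesis by simp
qed

text \<open>\<open>alternating_sum_inverse_pochhammer\<close> writes the \<open>r\<close>-dependent
  part of the connecting factor as a combination over \<open>j\<close> of the factors for
  \<open>r = 0\<close> with \<open>n + j\<close> in place of \<open>n\<close>. Each of these sums to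
  \<open>1 / (n + j) ^ p\<close>.\<close>

lemma has_sum_connected_kernel_left:
  assumes "a > -1" "p > 0" "q > 0" "l \<in> increasing_tuples q"
  shows "((\<lambda>k. connected_kernel p q r a k l) has_sum
           recip_prod a q l * (pochhammer (real (l ! 0)) r / fact r)
             * (\<Sum>j=0..r. (- 1) ^ j * real (r choose j) / (real (l ! (q - 1)) + real j) ^ p))
          (increasing_tuples p)"
proof -
  define n where "n = l ! (q - 1)"
  have n: "n > 0"
    using increasing_tuples_nth_ge_1[OF assms(4), of "q - 1"] assms by (simp add: n_def)
  let ?d = "\<lambda>j k. recip_prod a p k * (pochhammer (1 + a) (k ! (p - 1))
             / pochhammer (real (n + j) + a + 1) (k ! (p - 1)))"
  have "((\<lambda>k. \<Sum>j=0..r. (- 1) ^ j * real (r choose j) * ?d j k) has_sum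
          (\<Sum>j=0..r. (- 1) ^ j * real (r choose j) * (1 / real (n + j) ^ p))) (increasing_tuples p)"
    using n assms by (intro has_sum_sum has_sum_cmult_right has_sum_recip_prod_inverse_power) auto
  also have "(\<lambda>k. \<Sum>j=0..r. (- 1) ^ j * real (r choose j) * ?d j k) =
      (\<lambda>k. recip_prod a p k * pochhammer (1 + a) (k ! (p - 1)) *
         (\<Sum>j=0..r. (- 1) ^ j * real (r choose j) / pochhammer (real n + a + 1 + real j) (k ! (p - 1))))"
    by (simp add: sum_distrib_left add_ac mult_ac)
  also have "\<dots> = (\<lambda>k. recip_prod a p k * pochhammer (1 + a) (k ! (p - 1)) *
         (pochhammer (real (k ! (p - 1))) r / pochhammer (real n + a + 1) (k ! (p - 1) + r)))"
    using assms by (subst alternating_sum_inverse_pochhammer) auto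
  finally have "((\<lambda>k. recip_prod a p k * pochhammer (1 + a) (k ! (p - 1)) *
         (pochhammer (real (k ! (p - 1))) r / pochhammer (real n + a + 1) (k ! (p - 1) + r))) has_sum
          (\<Sum>j=0..r. (- 1) ^ j * real (r choose j) / (real n + real j) ^ p)) (increasing_tuples p)"
    by simp
  from has_sum_cmult_right[OF this, of "recip_prod a q l * (pochhammer (real (l ! 0)) r / fact r)"]
  show ?thesis
    by (simp add: connected_kernel_def n_def mult_ac)
qed

text \<open>The terms are at most those for \<open>q = 1\<close>, \<open>r = 0\<close>; swapping the two summations of the kernel turns
  that series into \<open>\<Sum>\<^sub>l 1 / ((l + a) l\<^sup>p)\<close>.\<close>

lemma summable_on_recip_prod:
  assumes "a > -1" "p > 0" "q > 0"
  shows "(\<lambda>k. recip_prod a p k / (real (k ! (p - 1)) + real r) ^ q) summable_on increasing_tuples p"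
proof -
  have "(\<lambda>l. 1 / (min 1 (1 + a)) * (1 / real l ^ 2)) summable_on {1..}"
  proof (rule summable_on_subset)
    show "(\<lambda>l. 1 / (min 1 (1 + a)) * (1 / real l ^ 2)) summable_on UNIV"
      using inverse_power_summable[of 2, where ?'a = real] assms
      by (intro summable_nonneg_imp_summable_on summable_mult) (auto simp: inverse_eq_divide)
  qed auto
  hence "(\<lambda>l. recip_prod a 1 [l] * (1 / real ([l] ! 0) ^ p)) summable_on {1..}"
  proof (rule summable_on_comparison_test)
    fix l :: nat assume l: "l \<in> {1..}"
    \<comment> \<open>Chosen so that \<open>b * l \<le> l + a\<close> for \<open>l \<ge> 1\<close>:
      if \<open>a < 0\<close> then \<open>l + a \<ge> l + a * l\<close>. The terms are thus at most
      \<open>1 / (b * l ^ 2)\<close>.\<close>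
    define b where "b = min 1 (1 + a)"
    have b: "b > 0" using assms by (simp add: b_def)
    have "b * real l \<le> real l + a"
    proof (cases "a \<ge> 0")
      case False
      hence "a * 1 \<ge> a * real l" using l by (intro mult_left_mono_neg) auto
      thus ?thesis using False by (simp add: b_def algebra_simps)
    qed (auto simp: b_def)
    moreover have la: "real l + a > 0" using l assms by simp
    moreover have "real l ^ p \<ge> real l ^ 1"
      using l assms by (intro power_increasing) auto
    ultimately have "(b * real l) * real l \<le> (real l + a) * real l ^ p"
      using l assms by (intro mult_mono) auto
    hence "1 / ((real l + a) * real l ^ p) \<le> 1 / ((b * real l) * real l)"
      using b l la by (intro divide_left_mono mult_pos_pos) auto
    thus "recip_prod a 1 [l] * (1 / real ([l] ! 0) ^ p) \<le> 1 / (min 1 (1 + a)) * (1 / real l ^ 2)"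
      by (simp add: recip_prod_def b_def power2_eq_square mult_ac)
    show "recip_prod a 1 [l] * (1 / real ([l] ! 0) ^ p) \<ge> 0"
      using l assms by (simp add: recip_prod_def)
  qed
  hence "(\<lambda>l. recip_prod a 1 l * (1 / real (l ! 0) ^ p)) summable_on increasing_tuples 1"
    using summable_on_reindex_bij_betw[OF increasing_tuples_1_bij,
        of "\<lambda>l. recip_prod a 1 l * (1 / real (l ! 0) ^ p)"] by simp
  then obtain S where S: "((\<lambda>l. recip_prod a 1 l * (1 / real (l ! 0) ^ p)) has_sum S) (increasing_tuples 1)"
    by (auto simp: summable_on_def)
  have "((\<lambda>k. recip_prod a p k / (real (k ! (p - 1)) + real 0) ^ 1) has_sum S) (increasing_tuples p)"
  proof (rule has_sum_swap_nonneg[where f = "\<lambda>l k. connected_kernel p 1 0 a k l"])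
    show "((\<lambda>k. connected_kernel p 1 0 a k l) has_sum recip_prod a 1 l * (1 / real (l ! 0) ^ p))
            (increasing_tuples p)" if "l \<in> increasing_tuples 1" for l
      using has_sum_connected_kernel_left[of a p 1 l 0] that assms by simp
    show "(connected_kernel p 1 0 a k has_sum recip_prod a p k / (real (k ! (p - 1)) + real 0) ^ 1)
            (increasing_tuples 1)" if "k \<in> increasing_tuples p" for k
      using has_sum_connected_kernel_right[of a p 1 k 0] that assms by simp
  qed (use S assms in \<open>auto intro: connected_kernel_nonneg\<close>)
  hence "(\<lambda>k. recip_prod a p k / real (k ! (p - 1))) summable_on increasing_tuples p"
    by (auto dest: has_sum_imp_summable)
  thus ?thesis
  proof (rule summable_on_comparison_test)
    fix k assume k: "k \<in> increasing_tuples p"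
    have n: "k ! (p - 1) \<ge> 1"
      using increasing_tuples_nth_ge_1[OF k] assms by simp
    have "real (k ! (p - 1)) \<le> (real (k ! (p - 1)) + real r) ^ 1" by simp
    also have "\<dots> \<le> (real (k ! (p - 1)) + real r) ^ q"
      using n assms by (intro power_increasing) auto
    finally show "recip_prod a p k / (real (k ! (p - 1)) + real r) ^ q \<le> recip_prod a p k / real (k ! (p - 1))"
      using n assms k by (intro divide_left_mono recip_prod_nonneg mult_pos_pos) auto
    show "recip_prod a p k / (real (k ! (p - 1)) + real r) ^ q \<ge> 0"
      using assms k by (intro divide_nonneg_nonneg recip_prod_nonneg) auto
  qed
qed

section \<open>The identity for exponents all equal to 1\<close>

text \<open>Both series are iterated sums of the same nonnegative kernel, and
  \<open>summable_on_recip_prod\<close> supplies convergence in one order. The common value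
  \<open>S\<close> records convergence and equality together.\<close>

lemma has_sum_recip_prod_duality:
  assumes "a > -1" "p > 0" "q > 0"
  obtains S where
    "((\<lambda>k. recip_prod a p k / (real (k ! (p - 1)) + real r) ^ q) has_sum S) (increasing_tuples p)"
    "((\<lambda>l. recip_prod a q l * (pochhammer (real (l ! 0)) r / fact r)
         * (\<Sum>j=0..r. (- 1) ^ j * real (r choose j) / (real (l ! (q - 1)) + real j) ^ p)) has_sum S)
      (increasing_tuples q)"
proof -
  obtain S where S:
    "((\<lambda>k. recip_prod a p k / (real (k ! (p - 1)) + real r) ^ q) has_sum S) (increasing_tuples p)"
    using summable_on_recip_prod[OF assms] by (auto simp: summable_on_def)
  moreover have "((\<lambda>l. recip_prod a q l * (pochhammer (real (l ! 0)) r / fact r)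
         * (\<Sum>j=0..r. (- 1) ^ j * real (r choose j) / (real (l ! (q - 1)) + real j) ^ p)) has_sum S)
      (increasing_tuples q)"
    by (rule has_sum_swap_nonneg[where f = "connected_kernel p q r a",
          OF has_sum_connected_kernel_right S connected_kernel_nonneg _ has_sum_connected_kernel_left])
      (use assms in auto)
  ultimately show thesis by (rule that)
qed

text \<open>Up to a positive factor this is the sum over \<open>k\<close> of the nonnegative kernel
  with \<open>a = 0\<close>, \<open>q = 1\<close> and \<open>l = [n]\<close>. It makes the weights
  of the right-hand side nonnegative despite the alternating signs.\<close>

lemma alternating_sum_inverse_power_nonneg:
  assumes "p > 0" "n > 0"
  shows "(\<Sum>j=0..r. (- 1) ^ j * real (r choose j) / (real n + real j) ^ p) \<ge> 0"
proof -
  have l: "[n] \<in> increasing_tuples 1" using assms by (simp add: increasing_tuples_def)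
  define c where "c = recip_prod 0 1 [n] * (pochhammer (real n) r / fact r)"
  have "c > 0"
    unfolding c_def recip_prod_def using assms by (intro mult_pos_pos divide_pos_pos pochhammer_pos) auto
  moreover have "c * (\<Sum>j=0..r. (- 1) ^ j * real (r choose j) / (real n + real j) ^ p) \<ge> 0"
    using has_sum_nonneg[OF has_sum_connected_kernel_left[of 0 p 1 "[n]" r]]
      connected_kernel_nonneg[of 0 p 1 _ "[n]" r] assms l by (simp add: c_def)
  ultimately show ?thesis by (simp add: zero_le_mult_iff)
qed

subsection \<open>Sums over compositions\<close>

definition positive_tuples :: "nat \<Rightarrow> nat list set" where
  "positive_tuples n = {xs. length xs = n \<and> (\<forall>x\<in>set xs. 1 \<le> x)}"

lemma positive_tuples_Suc_bij:
  "bij_betw (\<lambda>(xs, x). xs @ [x]) (positive_tuples n \<times> {1..}) (positive_tuples (Suc n))"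
proof (rule bij_betwI[where g = "\<lambda>xs. (butlast xs, last xs)"])
  show "(\<lambda>xs. (butlast xs, last xs)) \<in> positive_tuples (Suc n) \<rightarrow> positive_tuples n \<times> {1..}"
  proof
    fix xs :: "nat list" assume *: "xs \<in> positive_tuples (Suc n)"
    then obtain ys y where "xs = ys @ [y]"
      by (cases xs rule: rev_cases) (auto simp: positive_tuples_def)
    with * show "(butlast xs, last xs) \<in> positive_tuples n \<times> {1..}"
      by (auto simp: positive_tuples_def)
  qed
qed (auto simp: positive_tuples_def intro!: append_butlast_last_id)

text \<open>Exponent tuples are sorted by the excess \<open>m\<close> of their sum over
  \<open>n\<close>. All entries are at least 1, so the truncated subtraction in the inverse map is
  exact.\<close>

lemma compositions_bij:
  "bij_betw snd (SIGMA m : UNIV. compositions n (n + m)) (positive_tuples n)"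
proof (rule bij_betwI[where g = "\<lambda>xs. (sum_list xs - n, xs)"])
  have "n \<le> sum_list xs" if "xs \<in> positive_tuples n" for xs
    using that sum_list_mono[of xs "\<lambda>_. 1" "\<lambda>x. x"]
    by (auto simp: positive_tuples_def sum_list_triv)
  thus "(\<lambda>xs. (sum_list xs - n, xs)) \<in> positive_tuples n \<rightarrow> (SIGMA m : UNIV. compositions n (n + m))"
    by (auto simp: positive_tuples_def compositions_def)
qed (auto simp: positive_tuples_def compositions_def)

lemma finite_compositions: "finite (compositions n w)"
proof (rule finite_subset)
  show "compositions n w \<subseteq> {xs. set xs \<subseteq> {..w} \<and> length xs = n}"
    by (auto simp: compositions_def intro: member_le_sum_list)
  show "finite {xs. set xs \<subseteq> {..w} \<and> length xs = n}"
    by (rule finite_lists_length_eq) simp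
qed

text \<open>The numbers \<open>\<alpha> ! i - 1\<close> are honest differences and add up to
  \<open>m\<close>; hence \<open>x ^ m\<close> marks the compositions of \<open>n + m\<close> in the
  generating function.\<close>

lemma prod_power_compositions:
  fixes x :: real
  assumes "\<alpha> \<in> compositions n (n + m)"
  shows "(\<Prod>i<n. x ^ (\<alpha> ! i - 1)) = x ^ m"
proof -
  have pos: "\<alpha> ! i \<ge> 1" if "i < n" for i
    using assms that by (auto simp: compositions_def)
  have len: "length \<alpha> = n" using assms by (simp add: compositions_def)
  have "(\<Sum>i<n. (\<alpha> ! i - 1) + 1) = (\<Sum>i<n. \<alpha> ! i)"
    using pos by (intro sum.cong) (auto simp: Suc_le_eq)
  also have "\<dots> = n + m"
    using assms len by (simp add: compositions_def sum_list_sum_nth atLeast0LessThan)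
  finally have "(\<Sum>i<n. \<alpha> ! i - 1) = m"
    unfolding sum.distrib by simp
  thus ?thesis by (simp flip: power_sum)
qed

section \<open>Geometric expansions and generating functions\<close>

lemma has_sum_geometric_shifted:
  fixes x z :: real
  assumes "0 \<le> x" "x < z"
  shows "((\<lambda>n. x ^ (n - 1) / z ^ n) has_sum 1 / (z - x)) {1..}"
proof -
  have "(\<lambda>n. (x / z) ^ n) sums (1 / (1 - x / z))"
    using assms by (intro geometric_sums) auto
  from sums_divide[OF this, of z] have "(\<lambda>n. x ^ n / z ^ Suc n) sums (1 / (z - x))"
    using assms by (simp add: power_divide diff_divide_distrib[symmetric] divide_simps mult_ac)
  hence "((\<lambda>n. x ^ (Suc n - 1) / z ^ Suc n) has_sum 1 / (z - x)) UNIV"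
    using assms by (intro sums_nonneg_imp_has_sum) auto
  moreover have "bij_betw Suc UNIV {1..}"
    by (rule bij_betwI[where g = "\<lambda>n. n - 1"]) auto
  ultimately show ?thesis
    using has_sum_reindex_bij_betw[of Suc UNIV "{1..}" "\<lambda>n. x ^ (n - 1) / z ^ n"] by simp
qed

lemma has_sum_positive_tuples_geometric:
  fixes x :: real and z :: "nat \<Rightarrow> real"
  assumes "0 \<le> x" and "\<And>i. i < n \<Longrightarrow> x < z i"
  shows "((\<lambda>\<alpha>. \<Prod>i<n. x ^ (\<alpha> ! i - 1) / z i ^ (\<alpha> ! i)) has_sum (\<Prod>i<n. 1 / (z i - x)))
           (positive_tuples n)"
  using assms(2)
proof (induction n)
  case 0
  have "positive_tuples 0 = {[]}" by (auto simp: positive_tuples_def)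
  thus ?case by (simp add: has_sum_finite_iff)
next
  case (Suc n)
  let ?f = "\<lambda>n \<alpha>. \<Prod>i<n. x ^ (\<alpha> ! i - 1) / z i ^ (\<alpha> ! i)"
  have snoc: "?f (Suc n) (\<alpha> @ [j]) = ?f n \<alpha> * (x ^ (j - 1) / z n ^ j)" if "\<alpha> \<in> positive_tuples n" for \<alpha> j
    using that by (simp add: positive_tuples_def nth_append)
  have "((\<lambda>(\<alpha>, j). ?f (Suc n) (\<alpha> @ [j])) has_sum (\<Prod>i<n. 1 / (z i - x)) * (1 / (z n - x)))
          (positive_tuples n \<times> {1..})"
  proof (rule has_sum_Sigma_nonneg)
    show "((\<lambda>j. ?f (Suc n) (\<alpha> @ [j])) has_sum ?f n \<alpha> * (1 / (z n - x))) {1..}"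
      if "\<alpha> \<in> positive_tuples n" for \<alpha>
      unfolding snoc[OF that]
      using assms(1) Suc.prems by (intro has_sum_cmult_right has_sum_geometric_shifted) auto
    show "((\<lambda>\<alpha>. ?f n \<alpha> * (1 / (z n - x))) has_sum (\<Prod>i<n. 1 / (z i - x)) * (1 / (z n - x)))
            (positive_tuples n)"
      using Suc by (intro has_sum_cmult_left) auto
    have "z i > 0" if "i < Suc n" for i
      using Suc.prems[OF that] assms(1) by simp
    thus "?f (Suc n) (\<alpha> @ [j]) \<ge> 0" for \<alpha> j
      using assms(1) by (intro prod_nonneg ballI divide_nonneg_nonneg zero_le_power) (auto intro: less_imp_le)
  qed
  thus ?case
    using has_sum_reindex_bij_betw[OF positive_tuples_Suc_bij[of n], of "?f (Suc n)"]
    by (simp add: case_prod_unfold del: prod.lessThan_Suc) simp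
qed

text \<open>Each factor of \<open>recip_prod (a - x) p k\<close> is expanded as a geometric series
  in \<open>x\<close>, and the powers of \<open>x\<close> are collected. The weight \<open>w\<close>
  is left abstract so that both sides of the theorem are instances.\<close>

lemma recip_prod_expansion:
  assumes "a > -1" and w: "\<And>k. k \<in> increasing_tuples p \<Longrightarrow> w k \<ge> 0"
    and S: "\<And>x. 0 \<le> x \<Longrightarrow> x < 1 + a \<Longrightarrow>
      ((\<lambda>k. w k * recip_prod (a - x) p k) has_sum S x) (increasing_tuples p)"
  defines "f \<equiv> \<lambda>\<alpha> k. w k / (\<Prod>i<p. (real (k ! i) + a) ^ (\<alpha> ! i))"
  shows "\<alpha> \<in> compositions p (p + m) \<Longrightarrow> f \<alpha> summable_on increasing_tuples p"
    and "0 \<le> x \<Longrightarrow> x < 1 + a \<Longrightarrow>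
      (\<lambda>m. (\<Sum>\<alpha>\<in>compositions p (p + m). infsum (f \<alpha>) (increasing_tuples p)) * x ^ m) sums S x"
proof -
  let ?K = "increasing_tuples p"
  define F where "F x \<alpha> k = w k * (\<Prod>i<p. x ^ (\<alpha> ! i - 1) / (real (k ! i) + a) ^ (\<alpha> ! i))" for x \<alpha> k
  have F_eq: "F x \<alpha> k = x ^ m * f \<alpha> k" if "\<alpha> \<in> compositions p (p + m)" for x \<alpha> k m
    using prod_power_compositions[OF that, of x] by (simp add: F_def f_def prod_dividef)
  \<comment> \<open>Here \<open>k ! i + a \<ge> 1 + a > x \<ge> 0\<close>, so the geometric series
    converge with nonnegative terms and the order of summation is free.\<close>
  have sum: "((\<lambda>(\<alpha>, k). F x \<alpha> k) has_sum S x) (positive_tuples p \<times> ?K)" if x: "0 \<le> x" "x < 1 + a" for x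
  proof (rule has_sum_Sigma_flip_nonneg)
    fix k assume k: "k \<in> ?K"
    have z: "x < real (k ! i) + a" if "i < p" for i
      using increasing_tuples_nth_ge_1[OF k that] x by simp
    have "recip_prod (a - x) p k = (\<Prod>i<p. 1 / ((real (k ! i) + a) - x))"
      by (simp add: recip_prod_def algebra_simps)
    thus "((\<lambda>\<alpha>. F x \<alpha> k) has_sum w k * recip_prod (a - x) p k) (positive_tuples p)"
      unfolding F_def using has_sum_positive_tuples_geometric[OF x(1) z] by (simp add: has_sum_cmult_right)
    fix \<alpha>
    show "F x \<alpha> k \<ge> 0"
      unfolding F_def using x z w[OF k]
      by (intro mult_nonneg_nonneg prod_nonneg ballI divide_nonneg_nonneg zero_le_power)
        (auto intro: less_imp_le order_trans)
  next
    show "((\<lambda>k. w k * recip_prod (a - x) p k) has_sum S x) ?K"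
      by (rule S[OF x])
  qed auto
  have summable: "f \<alpha> summable_on ?K" if \<alpha>: "\<alpha> \<in> compositions p (p + m)" for \<alpha> m
  proof -
    \<comment> \<open>Any point strictly between 0 and \<open>1 + a\<close> serves:
      \<open>x > 0\<close> allows dividing \<open>F x \<alpha> k\<close> by
      \<open>x ^ m\<close>.\<close>
    define x where "x = (1 + a) / 2"
    have x: "0 < x" "x < 1 + a" using assms(1) by (auto simp: x_def)
    have "(\<lambda>(\<alpha>, k). F x \<alpha> k) summable_on (positive_tuples p \<times> ?K)"
      using sum[of x] x by (auto dest: has_sum_imp_summable)
    moreover have "\<alpha> \<in> positive_tuples p"
      using \<alpha> by (auto simp: positive_tuples_def compositions_def)
    ultimately have "F x \<alpha> summable_on ?K"
      by (rule summable_on_SigmaD1)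
    hence "(\<lambda>k. 1 / x ^ m * F x \<alpha> k) summable_on ?K"
      by (rule summable_on_cmult_right)
    thus ?thesis
      using x by (simp add: F_eq[OF \<alpha>])
  qed
  thus "\<alpha> \<in> compositions p (p + m) \<Longrightarrow> f \<alpha> summable_on ?K" .
  show "(\<lambda>m. (\<Sum>\<alpha>\<in>compositions p (p + m). infsum (f \<alpha>) ?K) * x ^ m) sums S x" if x: "0 \<le> x" "x < 1 + a"
  \<comment> \<open>The sum over \<open>k\<close> is taken first; then the exponent tuples are
    grouped by \<open>m\<close> into finite sets.\<close>
  proof (rule has_sum_imp_sums, rule has_sum_SigmaD)
    have row: "(F x \<alpha> has_sum x ^ m * infsum (f \<alpha>) ?K) ?K" if "\<alpha> \<in> compositions p (p + m)" for \<alpha> m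
      unfolding F_eq[OF that, abs_def] by (intro has_sum_cmult_right has_sum_infsum summable[OF that])
    have "((\<lambda>\<alpha>. infsum (F x \<alpha>) ?K) has_sum S x) (positive_tuples p)"
    proof (rule has_sum_SigmaD[OF sum[OF x]])
      fix \<alpha> assume "\<alpha> \<in> positive_tuples p"
      then obtain m where "\<alpha> \<in> compositions p (p + m)"
        using bij_betw_imp_surj_on[OF compositions_bij[of p]] by force
      from row[OF this] show "((\<lambda>k. case (\<alpha>, k) of (\<alpha>, k) \<Rightarrow> F x \<alpha> k) has_sum infsum (F x \<alpha>) ?K) ?K"
        by (auto simp: has_sum_iff)
    qed
    thus "((\<lambda>y. infsum (F x (snd y)) ?K) has_sum S x) (SIGMA m : UNIV. compositions p (p + m))"
      by (subst has_sum_reindex_bij_betw[OF compositions_bij])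
    fix m :: nat
    have "(\<Sum>\<alpha>\<in>compositions p (p + m). infsum (F x \<alpha>) ?K)
        = (\<Sum>\<alpha>\<in>compositions p (p + m). infsum (f \<alpha>) ?K) * x ^ m"
      unfolding sum_distrib_right
      by (rule sum.cong[OF refl]) (use row in \<open>auto simp: has_sum_iff mult.commute\<close>)
    thus "((\<lambda>\<alpha>. infsum (F x (snd (m, \<alpha>))) ?K) has_sum
            (\<Sum>\<alpha>\<in>compositions p (p + m). infsum (f \<alpha>) ?K) * x ^ m) (compositions p (p + m))"
      by (intro has_sum_finiteI finite_compositions) simp
  qed
qed

section \<open>Comparison of coefficients\<close>

text \<open>The summability conjuncts ensure that no infinite sum in the equation takes the default
  value 0 of a divergent one.\<close>

theorem theorem1p4:
  fixes p q r m :: nat and a :: real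
  assumes "p > 0" and "q > 0" and "a > -1"
  shows "(\<forall>\<alpha>\<in>compositions p (p + m). lhs_summand p q r a \<alpha> summable_on increasing_tuples p)
    \<and> (\<forall>\<beta>\<in>compositions q (q + m). rhs_summand p q r a \<beta> summable_on increasing_tuples q)
    \<and> (\<Sum>\<alpha>\<in>compositions p (p + m). \<Sum>\<^sub>\<infinity>k\<in>increasing_tuples p. lhs_summand p q r a \<alpha> k)
        = 1 / fact r *
          (\<Sum>\<beta>\<in>compositions q (q + m). \<Sum>\<^sub>\<infinity>l\<in>increasing_tuples q. rhs_summand p q r a \<beta> l)"
proof -
  \<comment> \<open>The weights \<open>u\<close> and \<open>v\<close> are the parts of the summands
    that do not involve the exponents. The factor \<open>1 / fact r\<close> is left out of
    \<open>v\<close>, so its sums are \<open>fact r * S x\<close>.\<close>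
  define u where "u k = 1 / (real (k ! (p - 1)) + real r) ^ q" for k
  define v where "v l = pochhammer (real (l ! 0)) r
      * (\<Sum>j=0..r. (- 1) ^ j * real (r choose j) / (real (l ! (q - 1)) + real j) ^ p)" for l
  have lhs: "lhs_summand p q r a \<alpha> = (\<lambda>k. u k / (\<Prod>i<p. (real (k ! i) + a) ^ (\<alpha> ! i)))" for \<alpha>
    unfolding lhs_summand_def[abs_def] u_def power_int_minus power_int_of_nat prod_inversef[unfolded comp_def]
    by (simp add: divide_inverse mult.commute)
  have rhs: "rhs_summand p q r a \<beta> = (\<lambda>l. v l / (\<Prod>i<q. (real (l ! i) + a) ^ (\<beta> ! i)))" for \<beta>
    unfolding rhs_summand_def[abs_def] v_def power_int_minus power_int_of_nat pochhammer_prod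
    by (simp add: divide_inverse atLeast0LessThan mult_ac)
  have u_nonneg: "u k \<ge> 0" for k
    by (simp add: u_def)
  have v_nonneg: "v l \<ge> 0" if "l \<in> increasing_tuples q" for l
    unfolding v_def using increasing_tuples_nth_ge_1[OF that] assms
    by (intro mult_nonneg_nonneg pochhammer_nonneg alternating_sum_inverse_power_nonneg)
      (auto simp: Suc_le_eq)
  have "\<exists>S. \<forall>x. 0 \<le> x \<and> x < 1 + a \<longrightarrow>
      ((\<lambda>k. u k * recip_prod (a - x) p k) has_sum S x) (increasing_tuples p) \<and>
      ((\<lambda>l. v l * recip_prod (a - x) q l) has_sum fact r * S x) (increasing_tuples q)"
  proof (intro choice allI)
    fix x
    show "\<exists>S. 0 \<le> x \<and> x < 1 + a \<longrightarrow>
        ((\<lambda>k. u k * recip_prod (a - x) p k) has_sum S) (increasing_tuples p) \<and>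
        ((\<lambda>l. v l * recip_prod (a - x) q l) has_sum fact r * S) (increasing_tuples q)"
    proof (cases "x < 1 + a")
      case True
      hence "a - x > -1" by simp
      from has_sum_recip_prod_duality[OF this assms(1,2), of r] obtain S where S:
        "((\<lambda>k. recip_prod (a - x) p k / (real (k ! (p - 1)) + real r) ^ q) has_sum S) (increasing_tuples p)"
        "((\<lambda>l. recip_prod (a - x) q l * (pochhammer (real (l ! 0)) r / fact r)
             * (\<Sum>j=0..r. (- 1) ^ j * real (r choose j) / (real (l ! (q - 1)) + real j) ^ p)) has_sum S)
          (increasing_tuples q)" by blast
      show ?thesis
        using S(1) has_sum_cmult_right[OF S(2), of "fact r"]
        by (intro exI[of _ S]) (simp add: u_def v_def mult_ac)
    qed auto
  qed
  then obtain S where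
    SL: "\<And>x. 0 \<le> x \<Longrightarrow> x < 1 + a \<Longrightarrow> ((\<lambda>k. u k * recip_prod (a - x) p k) has_sum S x) (increasing_tuples p)" and
    SR: "\<And>x. 0 \<le> x \<Longrightarrow> x < 1 + a \<Longrightarrow> ((\<lambda>l. v l * recip_prod (a - x) q l) has_sum fact r * S x) (increasing_tuples q)"
    by blast
  note L = recip_prod_expansion[OF assms(3) u_nonneg SL, folded lhs]
  note R = recip_prod_expansion[OF assms(3) v_nonneg SR, folded rhs]
  define A where "A m = (\<Sum>\<alpha>\<in>compositions p (p + m). \<Sum>\<^sub>\<infinity>k\<in>increasing_tuples p. lhs_summand p q r a \<alpha> k)" for m
  define B where "B m = (\<Sum>\<beta>\<in>compositions q (q + m). \<Sum>\<^sub>\<infinity>l\<in>increasing_tuples q. rhs_summand p q r a \<beta> l)" for m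
  \<comment> \<open>Both \<open>fact r * A m\<close> and \<open>B m\<close> are the coefficients of
    power series with sum \<open>fact r * S x\<close> for \<open>0 < x < 1 + a\<close>.\<close>
  have "fact r * A m - B m = 0"
  proof (rule powser_eq_0_right_imp_coeff_eq_0)
    show "1 + a > 0" using assms by simp
    fix x assume x: "0 < x" "x < 1 + a"
    have "(\<lambda>m. fact r * (A m * x ^ m) - B m * x ^ m) sums (fact r * S x - fact r * S x)"
      unfolding A_def B_def using L(2)[of x] R(2)[of x] x by (intro sums_diff sums_mult) auto
    thus "(\<lambda>m. (fact r * A m - B m) * x ^ m) sums 0"
      by (simp add: algebra_simps)
  qed
  hence "A m = 1 / fact r * B m" by (simp add: field_simps)
  thus ?thesis
    using L(1) R(1) by (simp add: A_def B_def)
qed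

end
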